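(* Every finite simple cactus graph $G$ with at least two vertices has a complete conflict-free coloring with $3$ colors, i.e. a map $C:V(G)\to\{1,2,3\}$ such that every $v\in V(G)$ has a color appearing exactly once in $N(v)$. Moreover, there exists a cactus graph $G$ with $\chi_{CF}(G)=3$.
   Context: A cactus graph is a connected graph in which any two cycles have at most one vertex in common. $N(v)$ is the open neighborhood of $v$; $\chi_{CF}(G)$ is the minimum number of colors in a complete conflict-free coloring of $G$ (every vertex colored, each vertex has a color occurring exactly once in its open neighborhood). *)

theory Defs
  imports "Graph_Theory.Digraph_Component" "HOL-Library.Extended_Nat"
begin

text \<open>
  A finite simple graph is a \<^locale>\<open>pair_graph\<close>: a finite, loop-free, symmetric set of arcs, each
  undirected edge being represented by its two orientations.
\<close>

text \<open>
  In a symmetric digraph every edge traversed back and forth is a \<^const>\<open>pre_digraph.cycle\<close> of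
  length two; the bound on the length rules these out.
\<close>

definition ugraph_cycle :: "'a pair_pre_digraph \<Rightarrow> ('a \<times> 'a) awalk \<Rightarrow> bool" where
  "ugraph_cycle G p \<longleftrightarrow> pre_digraph.cycle (with_proj G) p \<and> 3 \<le> length p"

definition cycle_verts :: "('a \<times> 'a) awalk \<Rightarrow> 'a set" where
  "cycle_verts p = fst ` set p"

definition cycle_edges :: "('a \<times> 'a) awalk \<Rightarrow> 'a set set" where
  "cycle_edges p = (\<lambda>(u, v). {u, v}) ` set p"

text \<open>
  Two arc walks describe the same cycle, up to starting point and orientation, iff they have the same
  undirected edges, so distinctness of cycles is distinctness of edge sets.
\<close>

definition cactus :: "'a pair_pre_digraph \<Rightarrow> bool" where
  "cactus G \<longleftrightarrow> connected (with_proj G) \<and>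
     (\<forall>p q. ugraph_cycle G p \<longrightarrow> ugraph_cycle G q \<longrightarrow> cycle_edges p \<noteq> cycle_edges q \<longrightarrow>
        card (cycle_verts p \<inter> cycle_verts q) \<le> 1)"

definition nbhd :: "'a pair_pre_digraph \<Rightarrow> 'a \<Rightarrow> 'a set" where
  "nbhd G v = {w. (v, w) \<in> parcs G}"

definition complete_cf_coloring :: "'a pair_pre_digraph \<Rightarrow> nat \<Rightarrow> ('a \<Rightarrow> nat) \<Rightarrow> bool" where
  "complete_cf_coloring G k C \<longleftrightarrow> C ` pverts G \<subseteq> {1..k} \<and>
     (\<forall>v \<in> pverts G. \<exists>c. \<exists>!w. w \<in> nbhd G v \<and> C w = c)"

text \<open>
  The value is \<open>\<infinity>\<close> if there is no complete conflict-free coloring, i.e. if there is an isolated vertex.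
\<close>

definition chi_CF :: "'a pair_pre_digraph \<Rightarrow> enat" where
  "chi_CF G = (INF k \<in> {k. \<exists>C. complete_cf_coloring G k C}. enat k)"

end

theory Submission
  imports Defs
begin

text \<open>
  In a depth-first tree every edge off the tree joins a vertex to an ancestor, and in a cactus every
  tree edge lies on at most one fundamental cycle. Let the color of its parent be the unique color in
  the neighbourhood of a vertex. The vertices are colored from the root downwards, and each of them
  then has to differ from at most two colors used before: that of its grandparent, and one forced by
  the back edge, if any, whose cycle contains the edge to its parent. So three colors suffice. In the
  triangle the two neighbours of each vertex must have different colors, so three are needed.
\<close>

section \<open>Depth-first trees\<close>

text \<open>
  The tree is encoded by the function \<open>pth\<close>, which sends a vertex to the list of its ancestors, from
  the vertex itself up to the root.
\<close>

locale dfs_tree =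
  fixes E :: "'a rel" and S :: "'a set" and r :: 'a and pth :: "'a \<Rightarrow> 'a list"
  assumes root_in: "r \<in> S"
    and pth_root: "pth r = [r]"
    and pth_step: "v \<in> S \<Longrightarrow> v \<noteq> r \<Longrightarrow> \<exists>u\<in>S. (v, u) \<in> E \<and> pth v = v # pth u"
    and comparable: "u \<in> S \<Longrightarrow> v \<in> S \<Longrightarrow> (u, v) \<in> E \<Longrightarrow> u \<in> set (pth v) \<or> v \<in> set (pth u)"

text \<open>
  Split off the component \<open>K\<close> of \<open>S - {r}\<close> containing some neighbour \<open>c\<close> of \<open>r\<close>: the only edges between
  \<open>K\<close> and \<open>S - K\<close> end in \<open>r\<close>, so a tree on \<open>K\<close> can be hung below the root of a tree on \<open>S - K\<close>.
\<close>

lemma dfs_tree_exists: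
  assumes "finite S" "sym E" "r \<in> S" "\<And>s. s \<in> S \<Longrightarrow> (r, s) \<in> (Restr E S)\<^sup>*"
  shows "\<exists>pth. dfs_tree E S r pth"
  using assms
proof (induction "card S" arbitrary: S r rule: less_induct)
  case less
  show ?case
  proof (cases "S = {r}")
    case True
    have "dfs_tree E S r (\<lambda>_. [r])"
      by unfold_locales (use True in auto)
    then show ?thesis by blast
  next
    case False
    then obtain s where "s \<in> S" "s \<noteq> r" using less.prems by auto
    then obtain c where c: "c \<in> S" "(r, c) \<in> E" "c \<noteq> r"
    proof -
      have "(r, s) \<in> (Restr E S)\<^sup>* \<Longrightarrow> s \<noteq> r \<Longrightarrow> \<exists>c\<in>S. (r, c) \<in> E \<and> c \<noteq> r"
        by (induction rule: rtrancl_induct) auto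
      then show ?thesis using that less.prems(4) \<open>s \<in> S\<close> \<open>s \<noteq> r\<close> by blast
    qed
    define K where "K = {k. (c, k) \<in> (Restr E (S - {r}))\<^sup>*}"
    have cK: "c \<in> K" by (simp add: K_def)
    have K_sub: "K \<subseteq> S - {r}"
    proof
      fix k assume "k \<in> K"
      then have "(c, k) \<in> (Restr E (S - {r}))\<^sup>*" by (simp add: K_def)
      then show "k \<in> S - {r}" by (cases rule: rtranclE) (use c in auto)
    qed
    have K_closed: "z \<in> K" if "y \<in> K" "(y, z) \<in> E" "z \<in> S" "z \<noteq> r" for y z
    proof -
      have "(y, z) \<in> Restr E (S - {r})" using that K_sub by auto
      then show ?thesis using that(1) unfolding K_def by (auto intro: rtrancl_into_rtrancl)
    qed
    have K_conn: "(c, k) \<in> (Restr E K)\<^sup>*" if "k \<in> K" for k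
    proof -
      have "(c, k) \<in> (Restr E (S - {r}))\<^sup>*" using that by (simp add: K_def)
      then have "k \<in> K \<and> (c, k) \<in> (Restr E K)\<^sup>*"
      proof (induction rule: rtrancl_induct)
        case base
        then show ?case using cK by simp
      next
        case (step y z)
        then have "z \<in> K" using K_closed by blast
        then have "(y, z) \<in> Restr E K" using step by auto
        then show ?case using step \<open>z \<in> K\<close> by (auto intro: rtrancl_into_rtrancl)
      qed
      then show ?thesis ..
    qed
    have rest_conn: "(r, s) \<in> (Restr E (S - K))\<^sup>*" if "s \<in> S - K" for s
    proof -
      have "(r, s) \<in> (Restr E S)\<^sup>*" using that less.prems by auto
      \<comment> \<open>A path that has entered \<open>K\<close> can leave it only through
        \<open>r\<close>, and there the empty path from \<open>r\<close> takes over.\<close>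
      then have "s \<in> K \<or> (r, s) \<in> (Restr E (S - K))\<^sup>*"
      proof (induction rule: rtrancl_induct)
        case (step y z)
        show ?case
        proof (cases "y \<in> K \<or> z \<in> K")
          case True
          then show ?thesis using step K_closed[of y z] by (cases "z = r") auto
        next
          case False
          then have "(y, z) \<in> Restr E (S - K)" using step by auto
          then show ?thesis using False step by (auto intro: rtrancl_into_rtrancl)
        qed
      qed auto
      then show ?thesis using that by auto
    qed
    have "K \<subset> S" "S - K \<subset> S" using K_sub \<open>r \<in> S\<close> cK c by auto
    then have "card K < card S" "card (S - K) < card S"
      using \<open>finite S\<close> by (simp_all add: psubset_card_mono)
    moreover have "finite K" using \<open>K \<subset> S\<close> \<open>finite S\<close> by (auto dest: finite_subset)
    ultimately obtain p q where "dfs_tree E K c p" "dfs_tree E (S - K) r q"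
      using less.hyps[of K c] less.hyps[of "S - K" r] less.prems cK K_conn rest_conn K_sub
      by blast
    then interpret P: dfs_tree E K c p + Q: dfs_tree E "S - K" r q by auto
    define pth where "pth v = (if v \<in> K then p v @ [r] else q v)" for v
    have p_self: "v \<in> set (p v)" if "v \<in> K" for v
      using P.pth_root P.pth_step[OF that] by (cases "v = c") auto
    have crossing: "v = r" if "u \<in> K" "v \<in> S - K" "(u, v) \<in> E" for u v
      using K_closed that by blast
    have "dfs_tree E S r pth"
    proof
      show "r \<in> S" "pth r = [r]" using less.prems K_sub Q.pth_root by (auto simp: pth_def)
    next
      fix v assume v: "v \<in> S" "v \<noteq> r"
      consider "v = c" | "v \<in> K" "v \<noteq> c" | "v \<in> S - K" using v by blast
      then show "\<exists>u\<in>S. (v, u) \<in> E \<and> pth v = v # pth u"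
      proof cases
        case 1
        then show ?thesis
          using cK P.pth_root Q.pth_root K_sub \<open>r \<in> S\<close> c symD[OF \<open>sym E\<close>]
          by (intro bexI[of _ r]) (auto simp: pth_def)
      next
        case 2
        then show ?thesis using P.pth_step[of v] K_sub by (auto simp: pth_def)
      next
        case 3
        then show ?thesis using Q.pth_step[of v] v by (auto simp: pth_def)
      qed
    next
      fix u v assume uv: "u \<in> S" "v \<in> S" "(u, v) \<in> E"
      then have "(v, u) \<in> E" using \<open>sym E\<close> by (auto dest: symD)
      then show "u \<in> set (pth v) \<or> v \<in> set (pth u)"
        using uv P.comparable[of u v] Q.comparable[of u v] crossing[of u v] crossing[of v u]
        by (auto simp: pth_def)
    qed
    then show ?thesis by blast
  qed
qed

section \<open>Ancestors and depth\<close>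

context dfs_tree
begin

text \<open>The second entry of the list; at the root it is \<open>hd []\<close>, about which
  nothing is known.\<close>

definition par :: "'a \<Rightarrow> 'a" where
  "par v = hd (tl (pth v))"

lemma pth_nonempty: "v \<in> S \<Longrightarrow> pth v \<noteq> []"
  using pth_root pth_step[of v] by (cases "v = r") auto

lemma hd_pth: "v \<in> S \<Longrightarrow> hd (pth v) = v"
  using pth_root pth_step[of v] by (cases "v = r") auto

lemma self_in_pth: "v \<in> S \<Longrightarrow> v \<in> set (pth v)"
  using hd_pth pth_nonempty hd_in_set by metis

lemma par:
  assumes "v \<in> S" "v \<noteq> r"
  shows "par v \<in> S" "(v, par v) \<in> E" "pth v = v # pth (par v)"
  using pth_step[OF assms] hd_pth by (auto simp: par_def)

lemma pth_inj: "u \<in> S \<Longrightarrow> v \<in> S \<Longrightarrow> pth u = pth v \<Longrightarrow> u = v"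
  using hd_pth by metis

text \<open>Climbing from \<open>v\<close> by parents passes through \<open>u\<close>, and from
  there on the list is that of \<open>u\<close>.\<close>

lemma ancestor_suffix:
  assumes "v \<in> S" "u \<in> set (pth v)"
  shows "u \<in> S \<and> (\<exists>xs. pth v = xs @ pth u)"
  using assms
proof (induction "length (pth v)" arbitrary: v rule: less_induct)
  case less
  show ?case
  proof (cases "v = r \<or> u = v")
    case True
    then show ?thesis using less pth_root by (auto intro: exI[of _ "[]"])
  next
    case False
    then have "u \<in> S \<and> (\<exists>xs. pth (par v) = xs @ pth u)"
      using less par[of v] by auto
    then show ?thesis using par(3)[of v] False less.prems by (metis append_Cons)
  qed
qed

lemma ancestor_in: "v \<in> S \<Longrightarrow> u \<in> set (pth v) \<Longrightarrow> u \<in> S"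
  using ancestor_suffix by blast

lemma ancestor_trans: "v \<in> S \<Longrightarrow> u \<in> set (pth v) \<Longrightarrow> t \<in> set (pth u) \<Longrightarrow> t \<in> set (pth v)"
  using ancestor_suffix[of v u] by auto

text \<open>\<open>length (pth v)\<close> is the depth of \<open>v\<close>, counted from 1 at the
  root. It makes ancestry antisymmetric and later ranks the vertices for the coloring.\<close>

lemma ancestor_shorter:
  assumes "v \<in> S" "u \<in> set (pth v)" "u \<noteq> v"
  shows "length (pth u) < length (pth v)"
proof -
  obtain xs where "pth v = xs @ pth u" using ancestor_suffix assms by blast
  moreover have "xs \<noteq> []" using calculation assms pth_inj ancestor_in by force
  ultimately show ?thesis by simp
qed

text \<open>A second \<open>v\<close> would make \<open>pth v\<close> a suffix of the shorter list
  \<open>pth (par v)\<close>.\<close>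

lemma distinct_pth: "v \<in> S \<Longrightarrow> distinct (pth v)"
proof (induction "length (pth v)" arbitrary: v rule: less_induct)
  case less
  show ?case
  proof (cases "v = r")
    case False
    note v = par[OF less.prems False]
    have "v \<notin> set (pth (par v))"
    proof
      assume "v \<in> set (pth (par v))"
      then obtain xs where "pth (par v) = xs @ pth v" using ancestor_suffix[OF v(1)] by blast
      then have "length (pth (par v)) = length xs + length (pth v)" by simp
      then show False using v(3) by simp
    qed
    then show ?thesis using less.hyps[of "par v"] v by simp
  qed (simp add: pth_root)
qed

end

section \<open>Fundamental cycles in a cactus\<close>

locale cactus_tree = pair_graph G + dfs_tree "parcs G" "pverts G" r pth
  for G :: "'a pair_pre_digraph" and r pth +
  assumes cactus: "cactus G"
begin

definition back_edge :: "'a \<Rightarrow> 'a \<Rightarrow> bool" where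
  "back_edge w u \<longleftrightarrow> w \<in> pverts G \<and> u \<in> set (pth w) \<and> u \<noteq> w \<and> u \<noteq> par w \<and> (w, u) \<in> parcs G"

text \<open>The cycle closed by the back edge \<open>{w, u}\<close> runs through the tree edge \<open>{x, par x}\<close>.\<close>

definition covers :: "'a \<Rightarrow> 'a \<Rightarrow> 'a \<Rightarrow> bool" where
  "covers w u x \<longleftrightarrow> x \<in> set (pth w) \<and> u \<in> set (pth x) \<and> x \<noteq> u"

text \<open>The climb from \<open>w\<close> to its ancestor \<open>u\<close> as an arc walk;
  \<open>xs\<close> stops just below \<open>u\<close>.\<close>

lemma tree_awalk:
  assumes "w \<in> pverts G" "u \<in> pverts G" "pth w = xs @ pth u"
  shows "awalk w (map (\<lambda>x. (x, par x)) xs) u"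
    and "pawalk_verts w (map (\<lambda>x. (x, par x)) xs) = xs @ [u]"
    and "set xs \<subseteq> pverts G - {r}"
  using assms
proof (induction xs arbitrary: w)
  case Nil
  {
    case 1
    then show ?case using pth_inj[of w u] by (simp add: awalk_Nil_iff)
  next
    case 2
    then show ?case using pth_inj[of w u] by simp
  }
next
  case (Cons a xs)
  have *: "a = w \<and> w \<noteq> r \<and> par w \<in> pverts G \<and> (w, par w) \<in> parcs G \<and> pth (par w) = xs @ pth u"
    if w: "w \<in> pverts G" "u \<in> pverts G" "pth w = (a # xs) @ pth u" for w
  proof -
    have "a = w" using hd_pth[OF w(1)] w(3) by simp
    moreover have "w \<noteq> r" using w pth_root pth_nonempty[of u] by auto
    ultimately show ?thesis using par[of w] w by simp
  qed
  {
    case 1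
    then show ?case using *[OF 1] Cons.IH(1)[of "par w"] by (simp add: awalk_Cons_iff)
  next
    case 2
    then show ?case using *[OF 2] Cons.IH(2)[of "par w"] by simp
  next
    case 3
    then show ?case using *[OF 3] Cons.IH(3)[of "par w"] 3 by simp
  }
qed simp

text \<open>The cycle goes down the arc from \<open>u\<close> to \<open>w\<close> and climbs back in
  the tree. That \<open>{u, w}\<close> is its only edge off the tree will tell such cycles
  apart.\<close>

lemma back_cycle:
  assumes "back_edge w u"
  obtains p where "ugraph_cycle G p" "{u, w} \<in> cycle_edges p"
    "cycle_edges p \<subseteq> insert {u, w} {{x, par x} | x. x \<in> pverts G - {r}}"
    "\<And>x. covers w u x \<Longrightarrow> {x, par x} \<subseteq> cycle_verts p"
proof -
  have w: "w \<in> pverts G" "u \<in> set (pth w)" "u \<noteq> w" "u \<noteq> par w" "(w, u) \<in> parcs G"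
    using assms by (auto simp: back_edge_def)
  obtain xs where xs: "pth w = xs @ pth u" using ancestor_suffix w by blast
  have u: "u \<in> pverts G" using ancestor_in w by blast
  note walk = tree_awalk[OF w(1) u xs]
  define p where "p = (u, w) # map (\<lambda>x. (x, par x)) xs"
  have "awalk u p u"
    using walk(1) arcs_symmetric[OF w(5)] by (simp add: p_def awalk_Cons_iff)
  \<comment> \<open>The walk visits \<open>u # xs @ [u]\<close>, whose tail is repetition-free
    because \<open>pth w\<close> is \<open>xs\<close> followed by \<open>pth u\<close>, which
    contains \<open>u\<close>.\<close>
  moreover have "distinct (xs @ [u])"
    using distinct_pth[OF w(1)] xs self_in_pth[OF u] by auto
  then have "distinct (tl (pawalk_verts u p))"
    using walk(2) by (simp add: p_def)
  ultimately have "cycle p" by (auto simp: cycle_def p_def)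
  have "xs \<noteq> []" using xs pth_inj[of w u] w u by auto
  \<comment> \<open>A single step would make \<open>u\<close> the parent of \<open>w\<close>. So the
    climb has at least two arcs and the cycle at least three.\<close>
  moreover have "xs \<noteq> [a]" for a
    using xs walk(3) par[of w] hd_pth[of w] pth_inj[of u "par w"] w u by auto
  ultimately have "2 \<le> length xs" by (metis Suc_1 Suc_leI length_0_conv length_Suc_conv
    less_2_cases_iff linorder_not_less One_nat_def)
  have "ugraph_cycle G p"
    using \<open>cycle p\<close> \<open>2 \<le> length xs\<close> by (simp add: ugraph_cycle_def p_def)
  moreover have "{u, w} \<in> cycle_edges p"
    "cycle_edges p \<subseteq> insert {u, w} {{x, par x} | x. x \<in> pverts G - {r}}"
    using walk(3) by (auto simp: cycle_edges_def p_def)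
  moreover have "{x, par x} \<subseteq> cycle_verts p" if "covers w u x" for x
  proof -
    have verts: "cycle_verts p = insert u (set xs)"
      by (auto simp: cycle_verts_def p_def image_image)
    have in_xs: "y \<in> set xs" if "covers w u y" for y
    proof -
      have y: "y \<in> set (pth w)" "u \<in> set (pth y)" "y \<noteq> u" using that by (auto simp: covers_def)
      then have "y \<in> pverts G" using ancestor_in w(1) by blast
      \<comment> \<open>Otherwise \<open>y\<close> and \<open>u\<close> would be proper ancestors of
        each other.\<close>
      then have "y \<notin> set (pth u)"
        using y u ancestor_shorter[of y u] ancestor_shorter[of u y] by auto
      then show ?thesis using y xs by auto
    qed
    have x: "x \<in> set (pth w)" "u \<in> set (pth x)" "x \<noteq> u" using that by (auto simp: covers_def)
    have "x \<in> pverts G" using ancestor_in w(1) x by blast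
    moreover have "x \<noteq> r" using x pth_root by auto
    ultimately have p: "par x \<in> pverts G" "pth x = x # pth (par x)" using par by auto
    then have "par x \<in> set (pth w)" "u \<in> set (pth (par x))"
      using x ancestor_trans[OF w(1) x(1), of "par x"] self_in_pth[OF p(1)] by auto
    \<comment> \<open>If \<open>par x\<close> is not \<open>u\<close>, it is covered as
      well.\<close>
    then have "par x \<in> insert u (set xs)" using in_xs by (auto simp: covers_def)
    then show ?thesis using verts in_xs[OF that] by simp
  qed
  ultimately show ?thesis using that by blast
qed

text \<open>Two different fundamental cycles through the tree edge \<open>{x, par x}\<close> would
  share both of its ends, against the cactus property.\<close>

lemma covers_unique:
  assumes "back_edge w u" "back_edge w' u'" "covers w u x" "covers w' u' x"
  shows "w = w' \<and> u = u'"
proof (rule ccontr)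
  assume neq: "\<not> ?thesis"
  obtain p where p: "ugraph_cycle G p" "{u, w} \<in> cycle_edges p"
    "cycle_edges p \<subseteq> insert {u, w} {{x, par x} | x. x \<in> pverts G - {r}}"
    "\<And>x. covers w u x \<Longrightarrow> {x, par x} \<subseteq> cycle_verts p"
    by (rule back_cycle[OF assms(1)]) (rule that)
  obtain q where q: "ugraph_cycle G q" "{u', w'} \<in> cycle_edges q"
    "cycle_edges q \<subseteq> insert {u', w'} {{x, par x} | x. x \<in> pverts G - {r}}"
    "\<And>x. covers w' u' x \<Longrightarrow> {x, par x} \<subseteq> cycle_verts q"
    by (rule back_cycle[OF assms(2)]) (rule that)
  have w: "w \<in> pverts G" "u \<in> set (pth w)" "u \<noteq> w" "u \<noteq> par w"
    and w': "w' \<in> pverts G" "u' \<in> set (pth w')" "u' \<noteq> w'"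
    using assms(1,2) by (auto simp: back_edge_def)
  \<comment> \<open>The deeper end of an edge is the descendant, so the edge determines the
    pair.\<close>
  have "{u, w} \<noteq> {u', w'}"
    using neq ancestor_shorter[OF w(1-3)] ancestor_shorter[OF w'] by (auto simp: doubleton_eq_iff)
  moreover have "{u, w} \<noteq> {y, par y}" if "y \<in> pverts G - {r}" for y
  proof
    assume "{u, w} = {y, par y}"
    \<comment> \<open>As \<open>u\<close> is not the parent of \<open>w\<close>, only the reversed
      matching remains, and it puts \<open>w\<close> above \<open>u\<close>.\<close>
    then have "u = y" "w = par y" using w by (auto simp: doubleton_eq_iff)
    then have "length (pth w) < length (pth u)" using par(3)[of y] that by simp
    then show False using ancestor_shorter[OF w(1-3)] by simp
  qed
  ultimately have "{u, w} \<notin> insert {u', w'} {{y, par y} | y. y \<in> pverts G - {r}}"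
    by blast
  then have "{u, w} \<notin> cycle_edges q" using q(3) by (rule contra_subsetD[rotated])
  then have "cycle_edges p \<noteq> cycle_edges q" using p(2) by metis
  then have "card (cycle_verts p \<inter> cycle_verts q) \<le> 1"
    using cactus p(1) q(1) by (auto simp: cactus_def)
  moreover have "{x, par x} \<subseteq> cycle_verts p \<inter> cycle_verts q"
    using p(4)[OF assms(3)] q(4)[OF assms(4)] by blast
  moreover have "finite (cycle_verts p \<inter> cycle_verts q)" by (simp add: cycle_verts_def)
  ultimately have "card {x, par x} \<le> 1" by (meson card_mono le_trans)
  moreover have "x \<in> pverts G" "x \<noteq> r"
    using assms(3) ancestor_in[OF w(1), of x] pth_root by (auto simp: covers_def)
  then have "x \<noteq> par x" using no_loops'[OF par(2)] by blast
  ultimately show False by simp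
qed

end

section \<open>Greedy coloring\<close>

text \<open>Well-founded recursion along \<open>key\<close>: the colors on \<open>F x\<close> are
  chosen before that of \<open>x\<close> and are fewer than \<open>k\<close>, so one is
  left.\<close>

lemma greedy_coloring:
  fixes key :: "'a \<Rightarrow> nat" and F :: "'a \<Rightarrow> 'a set"
  assumes key: "\<And>x y. y \<in> F x \<Longrightarrow> key y < key x"
    and few: "\<And>x. finite (F x) \<and> card (F x) < k"
  obtains C where "\<And>x. C x \<in> {1..k}" "\<And>x y. y \<in> F x \<Longrightarrow> C y \<noteq> C x"
proof -
  have "\<exists>C. \<forall>x. C x \<in> {1..k} - C ` F x"
  proof (rule dependent_wf_choice[of "{(y, x). y \<in> F x}"])
    show "wf {(y, x). y \<in> F x}"
      by (rule wf_subset[OF wf_measure[of key]]) (use key in auto)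
  next
    fix f g :: "'a \<Rightarrow> nat" and x c
    assume "\<And>z. (z, x) \<in> {(y, x). y \<in> F x} \<Longrightarrow> f z = g z"
    then have "f ` F x = g ` F x" by (intro image_cong) auto
    then show "c \<in> {1..k} - f ` F x \<longleftrightarrow> c \<in> {1..k} - g ` F x" by simp
  next
    fix x and f :: "'a \<Rightarrow> nat"
    have "card (f ` F x) < card {1..k}" using few[of x] card_image_le[of "F x" f] by simp
    moreover have "finite (f ` F x)" using few[of x] by simp
    ultimately have "\<not> {1..k} \<subseteq> f ` F x" using card_mono[of "f ` F x" "{1..k}"] by linarith
    then show "\<exists>c. c \<in> {1..k} - f ` F x" by auto
  qed
  then obtain C where C: "\<And>x. C x \<in> {1..k} - C ` F x" by blast
  show ?thesis
  proof (rule that)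
    show "C x \<in> {1..k}" for x using C[of x] by simp
    show "C y \<noteq> C x" if "y \<in> F x" for x y using C[of x] imageI[OF that, of C] by auto
  qed
qed

section \<open>Three colors suffice for a cactus\<close>

context cactus_tree
begin

text \<open>A vertex of least depth among those other than \<open>r\<close> works, since its parent
  is shallower.\<close>

lemma child_of_root:
  assumes "2 \<le> card (pverts G)"
  obtains c where "c \<in> pverts G" "c \<noteq> r" "par c = r"
proof -
  have "\<not> pverts G \<subseteq> {r}" using assms card_mono[of "{r}" "pverts G"] by auto
  then obtain c where c: "c \<in> pverts G \<and> c \<noteq> r"
    and least: "\<And>v. v \<in> pverts G \<and> v \<noteq> r \<Longrightarrow> length (pth c) \<le> length (pth v)"
    using ex_has_least_nat[of "\<lambda>v. v \<in> pverts G \<and> v \<noteq> r" _ "\<lambda>v. length (pth v)"] by blast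
  have "par c = r" using least[of "par c"] par[of c] c by force
  then show ?thesis using that c by blast
qed

text \<open>The root has no proper ancestor, and a child of the root has none but its
  parent.\<close>

lemma back_not_root:
  assumes "back_edge w u"
  shows "w \<noteq> r \<and> par w \<noteq> r"
proof
  show "w \<noteq> r" using assms pth_root by (auto simp: back_edge_def)
  then show "par w \<noteq> r" using assms par(3)[of w] pth_root by (auto simp: back_edge_def)
qed

text \<open>
  The neighbour of \<open>v\<close> whose color is to be unique is \<open>f v\<close>, the parent of \<open>v\<close>, or a fixed child \<open>c\<close> if
  \<open>v\<close> is the root. The set \<open>F x\<close> collects those vertices colored before \<open>x\<close> from which \<open>x\<close> has to
  differ. Apart from \<open>f (f x)\<close>, each of them comes from a back edge covering \<open>x\<close> that starts in \<open>x\<close> or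
  in a child of \<open>x\<close>, and there is at most one such edge.
\<close>

lemma three_coloring:
  assumes "2 \<le> card (pverts G)"
  shows "\<exists>C. complete_cf_coloring G 3 C"
proof -
  obtain c where c: "c \<in> pverts G" "c \<noteq> r" "par c = r"
    using child_of_root[OF assms] .
  have pth_c: "pth c = [c, r]" using par(3)[OF c(1,2)] c pth_root by simp
  define f where "f v = (if v = r then c else par v)" for v
  define B where "B x = {(w, u). back_edge w u \<and> covers w u x \<and> (w = x \<or> par w = x)}" for x
  \<comment> \<open>If \<open>w = x\<close>, then \<open>x\<close> and \<open>f u\<close> are both
    neighbours of \<open>u\<close>; if \<open>par w = x\<close>, then \<open>u\<close> and
    \<open>x = f w\<close> are both neighbours of \<open>w\<close>. For \<open>x = c\<close> the
    vertex \<open>f (f x)\<close> is \<open>c\<close> itself and is left out.\<close>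
  define F where "F x = (if x \<in> pverts G - {r} then
      (if x = c then {} else {f (f x)}) \<union> (\<lambda>(w, u). if w = x then f u else u) ` B x else {})" for x
  \<comment> \<open>Doubled depth with an offset: \<open>c\<close> comes after \<open>r\<close> but
    before its siblings \<open>x\<close>, for which \<open>f (f x) = c\<close> has the same depth as
    \<open>x\<close>.\<close>
  define key where "key x = 2 * length (pth x) + (if x = c then 0 else 1)" for x
  \<comment> \<open>This rules out \<open>x = c\<close> when \<open>key_f\<close> is applied to a
    back edge starting in \<open>x\<close>.\<close>
  have back_below_c: "\<not> back_edge c u" for u
    using pth_c c by (auto simp: back_edge_def)
  have key_f: "key (f t) < key x" if "x \<in> pverts G" "x \<noteq> c" "t \<in> set (pth x)" "t \<noteq> x" for t x
  proof (cases "t = r")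
    case True
    then have "2 \<le> length (pth x)"
      using ancestor_shorter[OF that(1,3,4)] pth_root by simp
    then show ?thesis using True that pth_c by (simp add: f_def key_def)
  next
    case False
    have "t \<in> pverts G" using ancestor_in that by blast
    then have "length (pth (par t)) < length (pth t)" using par(3)[of t] False by simp
    then show ?thesis
      using ancestor_shorter[OF that(1,3,4)] False that by (auto simp: f_def key_def)
  qed
  have key_F: "key y < key x" if y: "y \<in> F x" for x y
  proof -
    have x: "x \<in> pverts G" "x \<noteq> r" using y by (auto simp: F_def split: if_splits)
    consider "x \<noteq> c" "y = f (f x)" | u where "back_edge x u" "y = f u"
      | w u where "back_edge w u" "covers w u x" "y = u"
      using y x by (auto simp: F_def B_def split: if_splits)
    then show ?thesis
    proof cases
      case 1
      have "f x \<in> set (pth x)" "f x \<noteq> x"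
        using par[OF x] self_in_pth[of "par x"] distinct_pth[OF x(1)] x by (auto simp: f_def)
      then show ?thesis using key_f x 1 by blast
    next
      case 2
      then show ?thesis using key_f[of x u] x back_below_c by (auto simp: back_edge_def)
    next
      case 3
      then have "length (pth u) < length (pth x)"
        using ancestor_shorter[of x u] x by (auto simp: covers_def)
      then show ?thesis using 3 by (auto simp: key_def)
    qed
  qed
  have few: "finite (F x) \<and> card (F x) < 3" for x
  proof -
    have "\<exists>b. B x \<subseteq> {b}"
    proof (cases "B x = {}")
      case False
      then obtain b where "b \<in> B x" by auto
      then have "B x \<subseteq> {b}" using covers_unique by (fastforce simp: B_def)
      then show ?thesis ..
    qed simp
    then obtain b where "B x \<subseteq> {b}" ..
    then have "F x \<subseteq> {f (f x), (\<lambda>(w, u). if w = x then f u else u) b}"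
      by (auto simp: F_def split: if_splits)
    then show ?thesis
      using card_mono[of "{f (f x), (\<lambda>(w, u). if w = x then f u else u) b}" "F x"]
        card_insert_le_m1[of 2 "{(\<lambda>(w, u). if w = x then f u else u) b}" "f (f x)"]
      by (auto intro: finite_subset)
  qed
  obtain C :: "'a \<Rightarrow> nat" where C: "\<And>x. C x \<in> {1..3}" "\<And>x y. y \<in> F x \<Longrightarrow> C y \<noteq> C x"
    by (rule greedy_coloring[of F key 3, OF key_F few]) (assumption, rule that)
  have conflict: "C w \<noteq> C (f v)" if vw: "(v, w) \<in> parcs G" "w \<noteq> f v" for v w
  proof -
    have V: "v \<in> pverts G" "w \<in> pverts G" "v \<noteq> w"
      using in_arcsD1[OF vw(1)] in_arcsD2[OF vw(1)] no_loops'[OF vw(1)] .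
    \<comment> \<open>Whichever of \<open>f v\<close> and \<open>w\<close> is colored later has the
      other in its set \<open>F\<close>.\<close>
    have "f v \<in> F w \<or> w \<in> F (f v)"
      using comparable[OF V(1,2) vw(1)]
    proof
      assume w: "w \<in> set (pth v)"
      then have "v \<noteq> r" using V pth_root by auto
      note p = par[OF V(1) this]
      \<comment> \<open>Here \<open>w\<close> is above \<open>v\<close> but not its parent, so the
        constraint falls on \<open>par v\<close>, with the back edge starting in its child
        \<open>v\<close>.\<close>
      have "back_edge v w" using w V vw \<open>v \<noteq> r\<close> by (auto simp: back_edge_def f_def)
      moreover have "covers v w (par v)"
        using w V vw p self_in_pth[OF p(1)] \<open>v \<noteq> r\<close> by (auto simp: covers_def f_def)
      ultimately have vw_B: "(v, w) \<in> B (par v)" by (simp add: B_def)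
      have "w \<in> (\<lambda>(w, u). if w = par v then f u else u) ` B (par v)"
        by (rule rev_image_eqI[OF vw_B]) (use no_loops'[OF p(2)] in simp)
      then have "w \<in> F (par v)"
        using back_not_root[OF \<open>back_edge v w\<close>] p(1) by (simp add: F_def)
      then show ?thesis using \<open>v \<noteq> r\<close> by (simp add: f_def)
    next
      assume v: "v \<in> set (pth w)"
      then have "w \<noteq> r" using V pth_root by auto
      show ?thesis
      proof (cases "v = par w")
        case True
        \<comment> \<open>With \<open>w = c\<close> one would have \<open>v = r\<close> and
          \<open>f v = c = w\<close>.\<close>
        then have "w \<noteq> c" using c vw by (auto simp: f_def)
        then show ?thesis using True V \<open>w \<noteq> r\<close> by (simp add: F_def f_def)
      next
        case False
        then have "(w, v) \<in> B w"
          using v V vw arcs_symmetric[OF vw(1)] self_in_pth[OF V(2)] by (auto simp: B_def back_edge_def covers_def)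
        then have "f v \<in> (\<lambda>(x, u). if x = w then f u else u) ` B w"
          by (rule rev_image_eqI) simp
        then show ?thesis using V \<open>w \<noteq> r\<close> by (simp add: F_def)
      qed
    qed
    then show ?thesis using C(2)[of "f v" w] C(2)[of w "f v"] by auto
  qed
  have "\<exists>!w. w \<in> nbhd G v \<and> C w = C (f v)" if v: "v \<in> pverts G" for v
  proof (rule ex1I[of _ "f v"])
    show "f v \<in> nbhd G v \<and> C (f v) = C (f v)"
      using par(2)[OF v] arcs_symmetric[OF par(2)[OF c(1,2)]] c(3) by (auto simp: f_def nbhd_def)
    show "w = f v" if "w \<in> nbhd G v \<and> C w = C (f v)" for w
      using conflict[of v w] that by (auto simp: nbhd_def)
  qed
  moreover have "C ` pverts G \<subseteq> {1..3}"
    using C(1) by (simp add: image_subset_iff)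
  ultimately have "complete_cf_coloring G 3 C" unfolding complete_cf_coloring_def by blast
  then show ?thesis by blast
qed

end

text \<open>A connected symmetric digraph is strongly connected, so any vertex \<open>r\<close>
  reaches all others and can be the root of a depth-first tree.\<close>

lemma cactus_three_coloring:
  assumes "pair_graph G" "cactus G" "2 \<le> card (pverts G)"
  shows "\<exists>C. complete_cf_coloring G 3 C"
proof -
  interpret pair_graph G by fact
  obtain r where r: "r \<in> pverts G" using assms(3) by (cases "pverts G = {}") auto
  have "strongly_connected (with_proj G)"
    using assms(2) unfolding cactus_def
    by (intro symmetric_connected_imp_strongly_connected[OF sym_arcs]) simp
  then have reach: "(r, s) \<in> rtrancl_on (pverts G) (parcs G)" if "s \<in> pverts G" for s
    using that r by (auto simp: strongly_connected_def reachable_def)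
  have "(r, s) \<in> (Restr (parcs G) (pverts G))\<^sup>*" if "s \<in> pverts G" for s
    using reach[OF that]
    by (induction rule: rtrancl_on_induct) (auto intro: rtrancl_into_rtrancl)
  moreover have "sym (parcs G)" by (rule symI) (rule arcs_symmetric)
  ultimately obtain pth where "dfs_tree (parcs G) (pverts G) r pth"
    using dfs_tree_exists[of "pverts G" "parcs G" r] r pair_finite_verts by blast
  then interpret dfs_tree "parcs G" "pverts G" r pth .
  interpret cactus_tree G r pth by unfold_locales fact
  show ?thesis by (rule three_coloring) fact
qed

section \<open>The triangle\<close>

definition triangle :: "nat pair_pre_digraph" where
  "triangle = \<lparr>pverts = {0, 1, 2}, parcs = {(0, 1), (1, 0), (0, 2), (2, 0), (1, 2), (2, 1)}\<rparr>"

lemma triangle_simps [simp]: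
  "pverts triangle = {0, 1, 2}"
  "parcs triangle = {(0, 1), (1, 0), (0, 2), (2, 0), (1, 2), (2, 1)}"
  by (simp_all add: triangle_def)

lemma pair_graph_triangle: "pair_graph triangle"
  by unfold_locales (auto simp: symmetric_def intro!: symI)

text \<open>A cycle has as many distinct vertices as arcs, hence exactly three. All cycles then have
  the same edge set, which makes the cactus condition vacuous.\<close>

lemma triangle_cycle:
  assumes "ugraph_cycle triangle p"
  shows "cycle_edges p = {{0, 1}, {0, 2}, {1, 2}}"
proof -
  interpret pair_graph triangle by (rule pair_graph_triangle)
  obtain u where u: "awalk u p u" "distinct (tl (pawalk_verts u p))" "3 \<le> length p"
    using assms by (auto simp: ugraph_cycle_def cycle_def)
  have "set (pawalk_verts u p) \<subseteq> {0, 1, 2}" using u(1) by (rule awalkE) simp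
  then have "set (tl (pawalk_verts u p)) \<subseteq> {0, 1, 2}"
    by (cases "pawalk_verts u p") auto
  then have "length (tl (pawalk_verts u p)) \<le> 3"
    using u(2) card_mono[of "{0, 1, 2::nat}" "set (tl (pawalk_verts u p))"]
    by (simp add: distinct_card)
  \<comment> \<open>The vertex list is one longer than the walk, so its tail has one entry per
    arc.\<close>
  moreover have "length (pawalk_verts u p) = Suc (length p)" for u
    by (induction p arbitrary: u) auto
  ultimately have "length p = Suc (Suc (Suc 0))" using u(3) by simp
  then obtain a b d where "p = [a, b, d]" by (auto simp: length_Suc_conv)
  define x y z where "x = fst a" and "y = fst b" and "z = fst d"
  have "p = [(x, y), (y, z), (z, x)]"
    using u(1) unfolding \<open>p = [a, b, d]\<close> x_def y_def z_def
    by (simp add: awalk_Cons_iff awalk_Nil_iff prod_eq_iff)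
  moreover from this have "u = x" "distinct [x, y, z]" "{x, y, z} \<subseteq> {0, 1, 2}"
    using u by (auto simp: awalk_Cons_iff)
  then have "{{x, y}, {y, z}, {z, x}} = {{0, 1}, {0, 2}, {1, 2}}"
    by (auto simp: insert_commute)
  ultimately show ?thesis by (simp add: cycle_edges_def)
qed

lemma cactus_triangle: "cactus triangle"
proof -
  interpret pair_graph triangle by (rule pair_graph_triangle)
  have "(u, v) \<in> rtrancl_on {0, 1, 2} ((parcs triangle)\<^sup>s)"
    if "u \<in> {0, 1, 2}" "v \<in> {0, 1, 2}" for u v
  proof (cases "u = v")
    case False
    then have "(u, v) \<in> (parcs triangle)\<^sup>s" using that by (auto simp: symcl_def)
    then show ?thesis
      using that by (intro rtrancl_on_into_rtrancl_on[OF rtrancl_on_refl])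
  qed (use that in simp)
  then have "connected (with_proj triangle)"
    unfolding connected_conv by simp
  then show ?thesis using triangle_cycle by (simp add: cactus_def)
qed

text \<open>Each neighbourhood is a pair, which has a color occurring once only if its two colors
  differ; the three neighbourhoods are all the pairs.\<close>

lemma triangle_colors:
  assumes "complete_cf_coloring triangle k C"
  shows "3 \<le> k"
proof -
  have nbhd: "nbhd triangle 0 = {1, 2}" "nbhd triangle 1 = {0, 2}" "nbhd triangle 2 = {0, 1}"
    by (auto simp: nbhd_def)
  have neq: "C a \<noteq> C b" if ab: "nbhd triangle v = {a, b}" "v \<in> pverts triangle" "a \<noteq> b" for a b v
  proof
    assume "C a = C b"
    obtain c where "\<exists>!w. w \<in> {a, b} \<and> C w = c"
      using assms[unfolded complete_cf_coloring_def, THEN conjunct2, THEN bspec, OF ab(2)]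
      unfolding ab(1) by (rule exE)
    then have "\<exists>w. w \<in> {a, b} \<and> C w = c"
      and uniq: "\<And>x y. x \<in> {a, b} \<and> C x = c \<Longrightarrow> y \<in> {a, b} \<and> C y = c \<Longrightarrow> x = y"
      by blast+
    from this(1) have "C a = c" "C b = c" using \<open>C a = C b\<close> by auto
    then show False using uniq[of a b] ab(3) by simp
  qed
  have "C 1 \<noteq> C 2" "C 0 \<noteq> C 2" "C 0 \<noteq> C 1"
    using neq[OF nbhd(1)] neq[OF nbhd(2)] neq[OF nbhd(3)] by simp_all
  then have "card (C ` pverts triangle) = 3" by simp
  moreover have "C ` pverts triangle \<subseteq> {1..k}"
    using assms by (simp add: complete_cf_coloring_def)
  ultimately show ?thesis using card_mono[of "{1..k}" "C ` pverts triangle"] by simp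
qed

lemma chi_CF_triangle: "chi_CF triangle = 3"
proof (rule antisym)
  obtain C where "complete_cf_coloring triangle 3 C"
    using cactus_three_coloring[OF pair_graph_triangle cactus_triangle] by auto
  then have "chi_CF triangle \<le> enat 3" unfolding chi_CF_def by (intro INF_lower) auto
  then show "chi_CF triangle \<le> 3" by (simp add: numeral_eq_enat)
  show "3 \<le> chi_CF triangle"
    unfolding chi_CF_def by (intro INF_greatest) (auto simp: numeral_eq_enat dest: triangle_colors)
qed

theorem theorem4:
  shows "(\<forall>G :: 'a pair_pre_digraph.
            pair_graph G \<longrightarrow> cactus G \<longrightarrow> 2 \<le> card (pverts G) \<longrightarrow>
              (\<exists>C. complete_cf_coloring G 3 C)) \<and>
         (\<exists>H :: nat pair_pre_digraph. pair_graph H \<and> cactus H \<and> chi_CF H = 3)"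
  using cactus_three_coloring pair_graph_triangle cactus_triangle chi_CF_triangle by blast

end
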